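(* Let $p\ge 5$ be a prime and let $n:=2^{p-1}$. Define double-indexed sequences $A_r(k)$, $B_r(k)$ for integers $r,k\ge0$ by $A_r(0)=1$ and $B_r(0)=1$ for all $r$, and for $k\ge 1$ $$A_r(k)=(p-r-k)\,A_r(k-1)+4\,(p-2r)\,A_{r+1}(k-1),$$ $$B_r(k)=-2\,(n-r-k)\,B_r(k-1)-2\,(n-2r-1)\,B_{r+1}(k-1).$$ Then both ratios $$\frac{A_0(\lfloor p/2\rfloor)}{(p-1)(p-2)\cdots(p-\lfloor p/2\rfloor)},\qquad \frac{B_0(\lfloor n/2\rfloor)}{(n-1)(n-2)\cdots(n-\lfloor n/2\rfloor)}$$ are integers. Moreover, the number $2^p-1$ is prime if and only if $$\frac{A_0(\lfloor p/2\rfloor)}{(p-1)(p-2)\cdots(p-\lfloor p/2\rfloor)}\;\Big|\;\frac{B_0(\lfloor n/2\rfloor)}{(n-1)(n-2)\cdots(n-\lfloor n/2\rfloor)} .$$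
   Context: Divisibility is in the integers. *)

theory Defs
  imports Complex_Main "HOL-Computational_Algebra.Primes"
begin

(* The coefficients are taken in the integers: for general r and k, differences such as
   p - r - k may be negative, so truncated subtraction on nat would be wrong. *)

fun A_seq :: "nat \<Rightarrow> nat \<Rightarrow> nat \<Rightarrow> int" where
  "A_seq p r 0 = 1"
| "A_seq p r (Suc k) =
     (int p - int r - int (Suc k)) * A_seq p r k
     + 4 * (int p - 2 * int r) * A_seq p (r + 1) k"

fun B_seq :: "nat \<Rightarrow> nat \<Rightarrow> nat \<Rightarrow> int" where
  "B_seq n r 0 = 1"
| "B_seq n r (Suc k) =
     - 2 * (int n - int r - int (Suc k)) * B_seq n r k
     - 2 * (int n - 2 * int r - 1) * B_seq n (r + 1) k"

definition A_ratio :: "nat \<Rightarrow> rat" where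
  "A_ratio p = of_int (A_seq p 0 (p div 2)) / of_int (\<Prod>j=1..p div 2. int p - int j)"

definition B_ratio :: "nat \<Rightarrow> rat" where
  "B_ratio n = of_int (B_seq n 0 (n div 2)) / of_int (\<Prod>j=1..n div 2. int n - int j)"

end

theory Submission
  imports Defs "HOL-Number_Theory.Quadratic_Reciprocity"
begin

text \<open>
  Unrolling the recurrences and dividing by \<open>(N - 1) \<dots> (N - \<lfloor>N / 2\<rfloor>)\<close> leaves Waring's coefficients
  \<open>N / (N - j) * (N - j choose j)\<close>, those expressing \<open>x ^ N + y ^ N\<close> through \<open>x + y\<close> and \<open>x * y\<close>.
  The first ratio becomes \<open>x ^ p + y ^ p\<close> with \<open>x = 2\<close>, \<open>y = -1\<close>, that is \<open>2 ^ p - 1\<close>; the second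
  becomes, with \<open>x, y = 1 \<plusminus> \<surd>3\<close>, after removing a power of \<open>2\<close> by \<open>(1 + \<surd>3)\<^sup>2 = 2 * (2 + \<surd>3)\<close>, the Lucas--Lehmer number
  \<open>(2 + \<surd>3) ^ 2 ^ (p - 2) + (2 - \<surd>3) ^ 2 ^ (p - 2)\<close>. The equivalence is then the Lucas--Lehmer test.
\<close>

section \<open>Closed form of the recurrences\<close>

text \<open>Pascal's rule under the summation sign. It merges the two branches of the recurrence in
  the next induction step.\<close>

lemma sum_choose_Suc:
  fixes g :: "nat \<Rightarrow> 'a::comm_semiring_1"
  shows "(\<Sum>j\<le>Suc k. of_nat (Suc k choose j) * g j)
       = (\<Sum>j\<le>k. of_nat (k choose j) * g j) + (\<Sum>j\<le>k. of_nat (k choose j) * g (Suc j))"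
proof -
  have "(\<Sum>j\<le>Suc k. of_nat (Suc k choose j) * g j)
      = g 0 + (\<Sum>j\<le>k. of_nat (k choose Suc j) * g (Suc j)) + (\<Sum>j\<le>k. of_nat (k choose j) * g (Suc j))"
    by (subst sum.atMost_Suc_shift) (simp add: distrib_right sum.distrib add_ac)
  also have "g 0 + (\<Sum>j\<le>k. of_nat (k choose Suc j) * g (Suc j))
      = (\<Sum>j\<le>Suc k. of_nat (k choose j) * g j)"
    by (subst sum.atMost_Suc_shift) simp
  also have "\<dots> = (\<Sum>j\<le>k. of_nat (k choose j) * g j)"
    by (simp add: binomial_eq_0)
  finally show ?thesis .
qed

text \<open>
  Unfolding the recurrence sums over lattice paths that raise \<open>r\<close> in \<open>j\<close> of the \<open>k\<close> steps.
  The factor of a step that raises \<open>r\<close> depends on \<open>r\<close> only, and \<open>P - r - k\<close> is unchanged by such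
  a step, so all paths with the same \<open>j\<close> have the same weight.
\<close>
lemma lattice_recurrence_closed_form:
  fixes f :: "nat \<Rightarrow> nat \<Rightarrow> 'a::comm_ring_1"
  assumes f_0: "\<And>r. f r 0 = 1"
    and f_Suc: "\<And>r k. f r (Suc k) = \<alpha> * (P - of_nat r - of_nat (Suc k)) * f r k
                      + \<beta> * (Q - 2 * of_nat r) * f (Suc r) k"
  shows "f r k = (\<Sum>j\<le>k. of_nat (k choose j) *
           (\<alpha> ^ (k - j) * \<beta> ^ j * (\<Prod>i<j. Q - 2 * of_nat (r + i))
             * (\<Prod>i<k - j. P - of_nat r - of_nat k + of_nat i)))"
proof (induction k arbitrary: r)
  case 0
  show ?case by (simp add: f_0)
next
  case (Suc k)
  define g where "g = (\<lambda>j. \<alpha> ^ (Suc k - j) * \<beta> ^ j * (\<Prod>i<j. Q - 2 * of_nat (r + i))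
             * (\<Prod>i<Suc k - j. P - of_nat r - of_nat (Suc k) + of_nat i))"
  have "\<alpha> * (P - of_nat r - of_nat (Suc k)) * f r k = (\<Sum>j\<le>k. of_nat (k choose j) * g j)"
    unfolding Suc.IH sum_distrib_left g_def
  proof (rule sum.cong[OF refl])
    fix j assume "j \<in> {..k}"
    then have "Suc k - j = Suc (k - j)" by auto
    then show "\<alpha> * (P - of_nat r - of_nat (Suc k)) * (of_nat (k choose j) * (\<alpha> ^ (k - j) * \<beta> ^ j *
            (\<Prod>i<j. Q - 2 * of_nat (r + i)) * (\<Prod>i<k - j. P - of_nat r - of_nat k + of_nat i)))
       = of_nat (k choose j) * (\<alpha> ^ (Suc k - j) * \<beta> ^ j * (\<Prod>i<j. Q - 2 * of_nat (r + i)) *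
            (\<Prod>i<Suc k - j. P - of_nat r - of_nat (Suc k) + of_nat i))"
      by (simp add: prod.lessThan_Suc_shift algebra_simps del: prod.lessThan_Suc)
  qed
  moreover have "\<beta> * (Q - 2 * of_nat r) * f (Suc r) k = (\<Sum>j\<le>k. of_nat (k choose j) * g (Suc j))"
    unfolding Suc.IH sum_distrib_left g_def
    by (rule sum.cong[OF refl])
      (simp add: prod.lessThan_Suc_shift algebra_simps del: prod.lessThan_Suc)
  ultimately have "f r (Suc k) = (\<Sum>j\<le>Suc k. of_nat (Suc k choose j) * g j)"
    by (simp only: f_Suc sum_choose_Suc)
  then show ?case by (simp only: g_def)
qed

section \<open>Waring's coefficients\<close>

text \<open>
  \<open>lucas_coeff N j\<close> is \<open>N / (N - j) * (N - j choose j)\<close> for \<open>N > 0\<close> and \<open>2 * j \<le> N\<close>; the value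
  \<open>2\<close> at \<open>N = 0\<close> is what the recurrence requires.
\<close>
fun lucas_coeff :: "nat \<Rightarrow> nat \<Rightarrow> nat" where
  "lucas_coeff 0 j = (if j = 0 then 2 else 0)"
| "lucas_coeff (Suc 0) j = (if j = 0 then 1 else 0)"
| "lucas_coeff (Suc (Suc N)) 0 = 1"
| "lucas_coeff (Suc (Suc N)) (Suc j) = lucas_coeff (Suc N) (Suc j) + lucas_coeff N j"

lemma lucas_coeff_0_right: "N > 0 \<Longrightarrow> lucas_coeff N 0 = 1"
  by (cases "(N, 0::nat)" rule: lucas_coeff.cases) auto

lemma lucas_coeff_eq_0: "N < 2 * j \<Longrightarrow> lucas_coeff N j = 0"
  by (induction N j rule: lucas_coeff.induct) auto

text \<open>The quotient formula cleared of denominators, so that it can be proved in the naturals.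
  In the induction step the recursion reduces to
  \<open>(N + 1) * (N - 2 * j) + (j + 1) * N = (N + 2) * (N - j)\<close>.\<close>

lemma lucas_coeff_fact:
  "N > 0 \<Longrightarrow> 2 * j \<le> N \<Longrightarrow>
     lucas_coeff N j * fact j * fact (N - 2 * j) = N * (fact (N - 1 - j) :: nat)"
proof (induction N j rule: lucas_coeff.induct)
  case (4 N j)
  show ?case
  proof (cases "N = 0")
    case True
    then show ?thesis using 4 by simp
  next
    case False
    from 4 have "2 * j \<le> N" by simp
    with False have le: "Suc j \<le> N" by linarith
    define F where "F = (fact (N - Suc j) :: nat)"
    have IH2: "lucas_coeff N j * fact j * fact (N - 2 * j) = N * F"
      using 4 False by (simp add: F_def)
    \<comment> \<open>The factor \<open>N - 2 * j\<close> turns the factorial of the induction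
      hypothesis into \<open>fact (N - 2 * j)\<close>. If \<open>2 * j = N\<close> that hypothesis
      does not apply, but both sides are 0.\<close>
    have IH1: "lucas_coeff (Suc N) (Suc j) * fact (Suc j) * fact (N - 2 * j) = (N + 1) * F * (N - 2 * j)"
    proof (cases "2 * j = N")
      case True
      then show ?thesis by (simp add: lucas_coeff_eq_0)
    next
      case neq: False
      then have "fact (N - 2 * j) = (N - 2 * j) * (fact (Suc N - 2 * Suc j) :: nat)"
        using \<open>2 * j \<le> N\<close> fact_reduce[of "N - 2 * j", where ?'a = nat] by simp
      moreover have "lucas_coeff (Suc N) (Suc j) * fact (Suc j) * fact (Suc N - 2 * Suc j) = Suc N * F"
        using 4 neq by (simp add: F_def)
      ultimately show ?thesis by (simp only: Suc_eq_plus1 ac_simps)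
    qed
    have "lucas_coeff (Suc (Suc N)) (Suc j) * fact (Suc j) * fact (Suc (Suc N) - 2 * Suc j)
        = lucas_coeff (Suc N) (Suc j) * fact (Suc j) * fact (N - 2 * j)
          + Suc j * (lucas_coeff N j * fact j * fact (N - 2 * j))"
      by (simp add: algebra_simps)
    also have "\<dots> = ((N + 1) * (N - 2 * j) + Suc j * N) * F"
      by (simp only: IH1 IH2) (simp add: algebra_simps)
    also have "(N + 1) * (N - 2 * j) + Suc j * N = (N + 2) * (N - j)"
    proof -
      obtain d where "N = 2 * j + d" using \<open>2 * j \<le> N\<close> le_Suc_ex by blast
      then show ?thesis by (simp add: algebra_simps)
    qed
    also have "(N + 2) * (N - j) * F = Suc (Suc N) * fact (Suc (Suc N) - 1 - Suc j)"
      using le fact_reduce[of "N - j", where ?'a = nat]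
      by (simp add: F_def mult.assoc del: mult_Suc)
    finally show ?thesis .
  qed
next
  case (2 j)
  then have "j = 0" by simp
  then show ?case by simp
qed auto

text \<open>Both sides satisfy \<open>u (N + 2) = (x + y) * u (N + 1) - x * y * u N\<close> with
  initial values \<open>2\<close> and \<open>x + y\<close>.\<close>

lemma lucas_coeff_sum:
  fixes x y :: "'a::comm_ring_1"
  shows "(\<Sum>j\<le>N div 2. of_nat (lucas_coeff N j) * (x + y) ^ (N - 2 * j) * (- (x * y)) ^ j) = x ^ N + y ^ N"
proof -
  define f where "f = (\<lambda>N. \<Sum>j\<le>N div 2. of_nat (lucas_coeff N j) * (x + y) ^ (N - 2 * j) * (- (x * y)) ^ j)"
  have "f (Suc (Suc N)) = (x + y) * f (Suc N) - x * y * f N" for N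
  proof -
    let ?g = "\<lambda>j. of_nat (lucas_coeff (Suc N) (Suc j)) * (x + y) ^ (N - 2 * j) * (- (x * y)) ^ Suc j"
    \<comment> \<open>The range is extended to that of \<open>f (Suc (Suc N))\<close>. This adds an
      index only for even \<open>N\<close>, and there the coefficient vanishes.\<close>
    have "f (Suc N) = (\<Sum>j\<le>Suc (N div 2). of_nat (lucas_coeff (Suc N) j) * (x + y) ^ (Suc N - 2 * j) * (- (x * y)) ^ j)"
      unfolding f_def
    proof (rule sum.mono_neutral_left)
      show "\<forall>j\<in>{..Suc (N div 2)} - {..Suc N div 2}.
          of_nat (lucas_coeff (Suc N) j) * (x + y) ^ (Suc N - 2 * j) * (- (x * y)) ^ j = 0"
      proof
        fix j assume "j \<in> {..Suc (N div 2)} - {..Suc N div 2}"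
        then have "Suc N < 2 * j" by (simp add: not_le) linarith
        then show "of_nat (lucas_coeff (Suc N) j) * (x + y) ^ (Suc N - 2 * j) * (- (x * y)) ^ j = 0"
          by (simp add: lucas_coeff_eq_0)
      qed
    qed auto
    then have "(x + y) * f (Suc N) = (x + y) ^ Suc (Suc N)
        + (\<Sum>j\<le>N div 2. (x + y) * (of_nat (lucas_coeff (Suc N) (Suc j)) * (x + y) ^ (Suc N - 2 * Suc j) * (- (x * y)) ^ Suc j))"
      by (simp only: sum.atMost_Suc_shift distrib_left sum_distrib_left) (simp add: lucas_coeff_0_right)
    also have "(\<Sum>j\<le>N div 2. (x + y) * (of_nat (lucas_coeff (Suc N) (Suc j)) * (x + y) ^ (Suc N - 2 * Suc j) * (- (x * y)) ^ Suc j))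
        = (\<Sum>j\<le>N div 2. ?g j)"
    proof (rule sum.cong[OF refl])
      fix j assume "j \<in> {..N div 2}"
      show "(x + y) * (of_nat (lucas_coeff (Suc N) (Suc j)) * (x + y) ^ (Suc N - 2 * Suc j) * (- (x * y)) ^ Suc j) = ?g j"
      \<comment> \<open>For \<open>2 * j = N\<close> truncated subtraction spoils the exponent, but
        the coefficient is 0.\<close>
      proof (cases "Suc (2 * j) \<le> N")
        case True
        then have "N - 2 * j = Suc (Suc N - 2 * Suc j)" by simp
        then show ?thesis by (simp only: power_Suc ac_simps)
      qed (simp add: lucas_coeff_eq_0)
    qed
    finally have 1: "(x + y) * f (Suc N) = (x + y) ^ Suc (Suc N) + (\<Sum>j\<le>N div 2. ?g j)" .
    have 2: "- (x * y * f N) = (\<Sum>j\<le>N div 2. of_nat (lucas_coeff N j) * (x + y) ^ (N - 2 * j) * (- (x * y)) ^ Suc j)"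
      by (simp add: f_def sum_distrib_left sum_negf ac_simps)
    have "f (Suc (Suc N)) = (x + y) ^ Suc (Suc N) + ((\<Sum>j\<le>N div 2. ?g j)
        + (\<Sum>j\<le>N div 2. of_nat (lucas_coeff N j) * (x + y) ^ (N - 2 * j) * (- (x * y)) ^ Suc j))"
      unfolding f_def
      by (simp add: sum.atMost_Suc_shift distrib_right sum.distrib del: sum.atMost_Suc power_Suc mult_Suc_right)
        (simp add: distrib_right sum.distrib)
    then show ?thesis by (simp only: diff_conv_add_uminus 1 2 add.assoc)
  qed
  moreover have "f 0 = 2" "f (Suc 0) = x + y" by (simp_all add: f_def)
  ultimately have "f N = x ^ N + y ^ N"
  proof (induction N rule: induct_nat_012)
    case (ge2 N)
    then show ?case by (simp add: \<open>\<And>N. f (Suc (Suc N)) = _\<close> algebra_simps)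
  qed simp_all
  then show ?thesis by (simp only: f_def)
qed

section \<open>Evaluation of the path weights by factorials\<close>

lemma prod_rising_fact: "(\<Prod>i<m. int a + 1 + int i) * fact a = fact (a + m)"
proof (induction m)
  case (Suc m)
  have "(\<Prod>i<Suc m. int a + 1 + int i) * fact a = (int a + 1 + int m) * ((\<Prod>i<m. int a + 1 + int i) * fact a)"
    by (simp only: prod.lessThan_Suc ac_simps)
  also have "\<dots> = fact (a + Suc m)"
    unfolding Suc.IH by (simp add: add_ac)
  finally show ?case .
qed simp

lemma prod_falling_fact: "K < N \<Longrightarrow> (\<Prod>i=1..K. int N - int i) * fact (N - 1 - K) = fact (N - 1)"
proof (induction K)
  case (Suc K)
  then have "fact (N - 1 - K) = (int N - int (Suc K)) * fact (N - 1 - Suc K)"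
    using fact_reduce[of "N - 1 - K", where ?'a = int] by simp
  with Suc show ?case by (simp add: mult.assoc)
qed simp

text \<open>\<open>Q\<close> is the largest odd number up to \<open>N\<close>. Each step in
  \<open>j\<close> strips two consecutive factors from the factorial: the even one is
  \<open>2 * (K - j)\<close>, the odd one \<open>Q - 2 * j\<close>.\<close>

lemma fact_binomial_double_step_prod:
  fixes Q :: int
  assumes "N = 2 * K \<and> Q = int N - 1 \<or> N = 2 * K + 1 \<and> Q = int N"
  shows "j \<le> K \<Longrightarrow> 2 ^ j * (fact j * int (K choose j)) * (\<Prod>i<j. Q - 2 * int i) * fact (N - 2 * j) = fact N"
proof (induction j)
  case (Suc j)
  then have "2 * Suc j \<le> N" using assms by auto
  then have "fact (N - 2 * j) = (int N - 2 * int j) * (int N - 2 * int j - 1) * fact (N - 2 * Suc j)"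
    using fact_reduce[of "N - 2 * j", where ?'a = int] fact_reduce[of "N - 2 * j - 1", where ?'a = int]
    by (simp add: of_nat_diff mult.assoc)
  moreover have "(int N - 2 * int j) * (int N - 2 * int j - 1) = 2 * (int K - int j) * (Q - 2 * int j)"
  proof -
    from assms have "int N = 2 * int K \<and> Q = 2 * int K - 1 \<or> int N = 2 * int K + 1 \<and> Q = 2 * int K + 1"
      by auto
    then show ?thesis by (elim disjE conjE; simp only:) (simp_all add: algebra_simps)
  qed
  moreover have "Suc j * (K choose Suc j) = (K - j) * (K choose j)"
    by (simp only: binomial_absorption binomial_absorb_comp)
  then have "int (Suc j) * int (K choose Suc j) = int (K - j) * int (K choose j)"
    by (metis of_nat_mult)
  then have "fact (Suc j) * int (K choose Suc j) = (int K - int j) * (fact j * int (K choose j))"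
    using Suc.prems by (simp add: of_nat_diff ac_simps)
  ultimately have "2 ^ Suc j * (fact (Suc j) * int (K choose Suc j)) * (\<Prod>i<Suc j. Q - 2 * int i) * fact (N - 2 * Suc j)
      = 2 ^ j * (fact j * int (K choose j)) * (\<Prod>i<j. Q - 2 * int i) * fact (N - 2 * j)"
    by (simp only: power_Suc prod.lessThan_Suc ac_simps)
  also have "\<dots> = fact N" using Suc by simp
  finally show ?case .
qed simp

text \<open>After multiplication by \<open>fact j * fact (N - 2 * j) * fact (N - 1 - K)\<close> both
  sides become \<open>fact N * fact (N - 1 - j)\<close>.\<close>

lemma binomial_double_step_prod_eq_lucas_coeff:
  fixes Q :: int
  assumes NQ: "N = 2 * K \<and> Q = int N - 1 \<or> N = 2 * K + 1 \<and> Q = int N" and "N > 1" "j \<le> K"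
  shows "2 ^ j * int (K choose j) * (\<Prod>i<j. Q - 2 * int i) * (\<Prod>i<K - j. int N - int K + int i)
       = int (lucas_coeff N j) * (\<Prod>i=1..K. int N - int i)"
proof -
  define a where "a = N - 1 - K"
  have "K < N" "2 * j \<le> N" using NQ \<open>N > 1\<close> \<open>j \<le> K\<close> by auto
  then have a: "int N - int K = int a + 1" "a + (K - j) = N - 1 - j"
    using \<open>j \<le> K\<close> by (auto simp: a_def)
  have F: "fact N = int N * fact (N - 1)"
    using \<open>N > 1\<close> fact_reduce[of N, where ?'a = int] by simp
  have L: "int (lucas_coeff N j) * fact j * fact (N - 2 * j) = int N * fact (N - 1 - j)"
    using lucas_coeff_fact[of N j] \<open>N > 1\<close> \<open>2 * j \<le> N\<close>
    by (metis gr_implies_not0 not_gr_zero of_nat_fact of_nat_mult)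
  have "2 ^ j * int (K choose j) * (\<Prod>i<j. Q - 2 * int i) * (\<Prod>i<K - j. int N - int K + int i)
          * (fact j * fact (N - 2 * j) * fact a)
      = (2 ^ j * (fact j * int (K choose j)) * (\<Prod>i<j. Q - 2 * int i) * fact (N - 2 * j))
          * ((\<Prod>i<K - j. int a + 1 + int i) * fact a)"
    by (simp only: a(1) ac_simps)
  also have "\<dots> = int N * fact (N - 1) * fact (N - 1 - j)"
    by (simp only: fact_binomial_double_step_prod[OF NQ \<open>j \<le> K\<close>] prod_rising_fact a(2) F)
  also have "\<dots> = (int (lucas_coeff N j) * fact j * fact (N - 2 * j)) * ((\<Prod>i=1..K. int N - int i) * fact a)"
    unfolding L a_def prod_falling_fact[OF \<open>K < N\<close>] by (simp only: ac_simps)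
  also have "\<dots> = int (lucas_coeff N j) * (\<Prod>i=1..K. int N - int i) * (fact j * fact (N - 2 * j) * fact a)"
    by (simp only: ac_simps)
  finally show ?thesis by simp
qed

text \<open>Common form of the two sequences: \<open>A_seq\<close> has \<alpha> = 1, \<gamma> = 2
  with \<open>N\<close> odd, and \<open>B_seq\<close> has \<alpha> = -2, \<gamma> = -1 with
  \<open>N\<close> even. The 2 split off from the second coefficient supplies the power
  \<open>2 ^ j\<close> of the preceding lemma.\<close>

lemma lattice_recurrence_eq_lucas_sum:
  fixes f :: "nat \<Rightarrow> nat \<Rightarrow> int"
  assumes NQ: "N = 2 * K \<and> Q = int N - 1 \<or> N = 2 * K + 1 \<and> Q = int N" and "N > 1"
    and f_0: "\<And>r. f r 0 = 1"
    and f_Suc: "\<And>r k. f r (Suc k) = \<alpha> * (int N - int r - int (Suc k)) * f r k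
                      + (2 * \<gamma>) * (Q - 2 * int r) * f (Suc r) k"
  shows "f 0 K = (\<Sum>j\<le>K. int (lucas_coeff N j) * \<alpha> ^ (K - j) * \<gamma> ^ j) * (\<Prod>i=1..K. int N - int i)"
proof -
  have "f 0 K = (\<Sum>j\<le>K. int (K choose j) * (\<alpha> ^ (K - j) * (2 * \<gamma>) ^ j * (\<Prod>i<j. Q - 2 * int (0 + i))
             * (\<Prod>i<K - j. int N - int 0 - int K + int i)))"
    by (rule lattice_recurrence_closed_form) (rule f_0 f_Suc)+
  also have "\<dots> = (\<Sum>j\<le>K. \<alpha> ^ (K - j) * \<gamma> ^ j * (int (lucas_coeff N j) * (\<Prod>i=1..K. int N - int i)))"
  proof (rule sum.cong[OF refl])
    fix j assume "j \<in> {..K}"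
    then show "int (K choose j) * (\<alpha> ^ (K - j) * (2 * \<gamma>) ^ j * (\<Prod>i<j. Q - 2 * int (0 + i))
             * (\<Prod>i<K - j. int N - int 0 - int K + int i))
        = \<alpha> ^ (K - j) * \<gamma> ^ j * (int (lucas_coeff N j) * (\<Prod>i=1..K. int N - int i))"
      using binomial_double_step_prod_eq_lucas_coeff[OF NQ \<open>N > 1\<close>, of j, symmetric]
      by (simp add: power_mult_distrib)
  qed
  also have "\<dots> = (\<Sum>j\<le>K. int (lucas_coeff N j) * \<alpha> ^ (K - j) * \<gamma> ^ j) * (\<Prod>i=1..K. int N - int i)"
    unfolding sum_distrib_right by (simp only: ac_simps)
  finally show ?thesis .
qed

lemma falling_prod_ratio:
  "K < N \<Longrightarrow> rat_of_int (c * (\<Prod>i=1..K. int N - int i)) / of_int (\<Prod>i=1..K. int N - int i) = of_int c"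
proof -
  assume "K < N"
  then have "(\<Prod>i=1..K. int N - int i) \<noteq> 0" by auto
  then show ?thesis by (simp only: of_int_mult) (simp del: of_int_prod)
qed

section \<open>The Lucas--Lehmer test\<close>

text \<open>Integer pairs instead of real numbers: in the field of reals divisibility would be
  trivial, whereas here \<open>dvd\<close> by an integer expresses congruence in Z[sqrt 3].\<close>

datatype zsqrt3 = ZSqrt3 (rat_part: int) (sqrt_part: int)

lemma zsqrt3_eq_iff: "x = y \<longleftrightarrow> rat_part x = rat_part y \<and> sqrt_part x = sqrt_part y"
  by (auto intro: zsqrt3.expand)

instantiation zsqrt3 :: comm_ring_1
begin

definition "0 = ZSqrt3 0 0"
definition "1 = ZSqrt3 1 0"
definition "- x = ZSqrt3 (- rat_part x) (- sqrt_part x)"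
definition "x + y = ZSqrt3 (rat_part x + rat_part y) (sqrt_part x + sqrt_part y)"
definition "x - y = ZSqrt3 (rat_part x - rat_part y) (sqrt_part x - sqrt_part y)"
definition "x * y = ZSqrt3 (rat_part x * rat_part y + 3 * sqrt_part x * sqrt_part y)
                           (rat_part x * sqrt_part y + sqrt_part x * rat_part y)"

instance
  by standard
    (simp_all add: zero_zsqrt3_def one_zsqrt3_def uminus_zsqrt3_def plus_zsqrt3_def
      minus_zsqrt3_def times_zsqrt3_def algebra_simps)

end

lemma zsqrt3_parts [simp]:
  "rat_part 0 = 0" "sqrt_part 0 = 0" "rat_part 1 = 1" "sqrt_part 1 = 0"
  "rat_part (- x) = - rat_part x" "sqrt_part (- x) = - sqrt_part x"
  "rat_part (x + y) = rat_part x + rat_part y" "sqrt_part (x + y) = sqrt_part x + sqrt_part y"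
  "rat_part (x - y) = rat_part x - rat_part y" "sqrt_part (x - y) = sqrt_part x - sqrt_part y"
  "rat_part (x * y) = rat_part x * rat_part y + 3 * sqrt_part x * sqrt_part y"
  "sqrt_part (x * y) = rat_part x * sqrt_part y + sqrt_part x * rat_part y"
  by (simp_all add: zero_zsqrt3_def one_zsqrt3_def uminus_zsqrt3_def plus_zsqrt3_def
      minus_zsqrt3_def times_zsqrt3_def)

lemma zsqrt3_parts_of_nat [simp]: "rat_part (of_nat n) = int n" "sqrt_part (of_nat n) = 0"
  by (induction n) simp_all

lemma zsqrt3_parts_of_int [simp]: "rat_part (of_int k) = k" "sqrt_part (of_int k) = 0"
  by (cases k rule: int_cases; simp)+

lemma zsqrt3_parts_numeral [simp]: "rat_part (numeral k) = numeral k" "sqrt_part (numeral k) = 0"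
  using zsqrt3_parts_of_int[of "numeral k"] by simp_all

lemma of_int_dvd_zsqrt3_iff: "of_int m dvd x \<longleftrightarrow> m dvd rat_part x \<and> m dvd sqrt_part x"
proof
  assume "m dvd rat_part x \<and> m dvd sqrt_part x"
  then obtain a b where "rat_part x = m * a" "sqrt_part x = m * b" by (auto elim!: dvdE)
  then have "x = of_int m * ZSqrt3 a b" by (simp add: zsqrt3_eq_iff)
  then show "of_int m dvd x" by simp
qed auto

definition conj3 :: "zsqrt3 \<Rightarrow> zsqrt3" where
  "conj3 x = ZSqrt3 (rat_part x) (- sqrt_part x)"

lemma conj3_parts [simp]: "rat_part (conj3 x) = rat_part x" "sqrt_part (conj3 x) = - sqrt_part x"
  by (simp_all add: conj3_def)

lemma conj3_mult: "conj3 (x * y) = conj3 x * conj3 y"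
  by (simp add: zsqrt3_eq_iff)

lemma conj3_power: "conj3 (x ^ k) = conj3 x ^ k"
proof (induction k)
  case 0
  show ?case by (simp add: zsqrt3_eq_iff)
qed (simp add: conj3_mult)

lemma one_plus_sqrt3_square: "ZSqrt3 1 1 ^ 2 = 2 * ZSqrt3 2 1"
  by (simp add: zsqrt3_eq_iff power2_eq_square)

lemma unit_power_mult_conj3: "ZSqrt3 2 1 ^ k * conj3 (ZSqrt3 2 1 ^ k) = 1"
proof -
  have "ZSqrt3 2 1 * conj3 (ZSqrt3 2 1) = 1" by (simp add: zsqrt3_eq_iff)
  then show ?thesis by (simp add: conj3_power flip: power_mult_distrib)
qed

text \<open>Squaring a + b sqrt 3 gives rational part a^2 + 3 b^2, and norm 1 means 3 b^2 = a^2 - 1.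
  For s = 2 a this is the Lucas--Lehmer step from s to s^2 - 2.\<close>

lemma rat_part_unit_power_double:
  "rat_part (ZSqrt3 2 1 ^ (2 * k)) = 2 * rat_part (ZSqrt3 2 1 ^ k) ^ 2 - 1"
proof -
  let ?x = "ZSqrt3 2 1 ^ k"
  have "rat_part (?x * conj3 ?x) = 1" by (simp only: unit_power_mult_conj3 zsqrt3_parts)
  moreover have "ZSqrt3 2 1 ^ (2 * k) = ?x * ?x" by (simp only: mult_2 power_add)
  ultimately show ?thesis by (simp add: power2_eq_square)
qed

lemma sqrt_part_unit_power_double:
  "sqrt_part (ZSqrt3 2 1 ^ (2 * k)) = 2 * rat_part (ZSqrt3 2 1 ^ k) * sqrt_part (ZSqrt3 2 1 ^ k)"
proof -
  let ?x = "ZSqrt3 2 1 ^ k"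
  have "ZSqrt3 2 1 ^ (2 * k) = ?x * ?x" by (simp only: mult_2 power_add)
  then show ?thesis by simp
qed

section \<open>Congruences between powers\<close>

lemma dvd_power_diff:
  fixes x y :: "'a::comm_ring_1"
  assumes "d dvd x - y"
  shows "d dvd x ^ k - y ^ k"
  using assms by (simp add: power_diff_sumr2)

text \<open>The Frobenius congruence: a prime \<open>q\<close> divides all inner binomial
  coefficients of the expansion.\<close>

lemma prime_dvd_binomial_power_diff:
  fixes x y :: "'a::comm_ring_1"
  assumes "prime q"
  shows "of_nat q dvd (x + y) ^ q - (x ^ q + y ^ q)"
proof -
  obtain m where m: "q = Suc m" "0 < m"
    using prime_gt_1_nat[OF assms] by (cases q) auto
  have "(x + y) ^ q = (\<Sum>k\<le>q. of_nat (q choose k) * x ^ k * y ^ (q - k))"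
    by (rule binomial_ring)
  also have "{..q} = insert 0 (insert q {1..<q})" using m by auto
  also have "(\<Sum>k\<in>\<dots>. of_nat (q choose k) * x ^ k * y ^ (q - k))
      = y ^ q + (x ^ q + (\<Sum>k=1..<q. of_nat (q choose k) * x ^ k * y ^ (q - k)))"
    using m by simp
  finally have eq: "(x + y) ^ q - (x ^ q + y ^ q) = (\<Sum>k=1..<q. of_nat (q choose k) * x ^ k * y ^ (q - k))"
    by (simp add: algebra_simps)
  have "of_nat q dvd (of_nat (q choose k) * x ^ k * y ^ (q - k) :: 'a)" if "k \<in> {1..<q}" for k
  proof -
    have "q dvd q choose k" using that assms by (intro dvd_choose_prime) auto
    then obtain c where "q choose k = q * c" by (elim dvdE)
    then show ?thesis by simp
  qed
  then show ?thesis unfolding eq by (rule dvd_sum)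
qed

section \<open>The two directions of the Lucas--Lehmer test\<close>

text \<open>
  The hypothesis makes \<open>2 + \<surd>3\<close> an element of order exactly \<open>2 ^ p\<close> modulo \<open>q\<close>, and there are only
  \<open>q\<^sup>2\<close> residues.
\<close>
lemma unit_power_order_bound:
  fixes q :: int
  assumes "odd q" "q > 1" "p \<ge> 2" and dvd: "q dvd rat_part (ZSqrt3 2 1 ^ (2 ^ (p - 2)))"
  shows "2 ^ p \<le> q ^ 2"
proof -
  define w where "w = ZSqrt3 2 1"
  have half: "2 ^ (p - 1) = (2 * 2 ^ (p - 2) :: nat)"
    using \<open>p \<ge> 2\<close> by (simp add: Suc_diff_le numeral_2_eq_2 flip: power_Suc)
  \<comment> \<open>With a, b the parts of \<open>w ^ 2 ^ (p - 2)\<close>, the parts of the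
    difference are 2 a^2 and 2 a b, both multiples of a.\<close>
  have w_half: "of_int q dvd w ^ (2 ^ (p - 1)) - (-1)"
    unfolding of_int_dvd_zsqrt3_iff w_def half
    using dvd by (simp add: rat_part_unit_power_double sqrt_part_unit_power_double power2_eq_square)
  \<comment> \<open>Write \<open>d\<close> as \<open>2 ^ a * m\<close> with \<open>m\<close> odd and
    \<open>a < p\<close>. A suitable power of \<open>w ^ d\<close> is the \<open>m\<close>-th power
    of \<open>w ^ 2 ^ (p - 1)\<close>, which would be congruent to both 1 and -1, so
    \<open>q\<close> would divide 2.\<close>
  have no_period: "\<not> of_int q dvd w ^ d - 1" if "0 < d" "d < 2 ^ p" for d
  proof
    assume d: "of_int q dvd w ^ d - 1"
    obtain m where "d = 2 ^ multiplicity 2 d * m" "odd m"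
      by (rule multiplicity_decompose'[of d 2]) (use \<open>0 < d\<close> in auto)
    then obtain a where m: "d = 2 ^ a * m" "odd m" by blast
    have "(2::nat) ^ a \<le> d" using m \<open>0 < d\<close> by (cases m) auto
    then have "(2::nat) ^ a < 2 ^ p" using that(2) by (rule le_less_trans)
    then have "a < p" by (rule power_less_imp_less_exp[rotated]) simp
    then have "d * 2 ^ (p - 1 - a) = 2 ^ (p - 1) * m"
      by (simp add: m flip: power_add)
    then have "of_int q dvd (w ^ 2 ^ (p - 1)) ^ m - 1"
      using dvd_power_diff[OF d, of "2 ^ (p - 1 - a)"] by (simp flip: power_mult)
    moreover have "of_int q dvd (w ^ 2 ^ (p - 1)) ^ m - (-1)"
      using dvd_power_diff[OF w_half, of m] \<open>odd m\<close> by simp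
    ultimately have "of_int q dvd ((w ^ 2 ^ (p - 1)) ^ m - (-1)) - ((w ^ 2 ^ (p - 1)) ^ m - 1)"
      by (rule dvd_diff[rotated])
    then have "of_int q dvd (2 :: zsqrt3)" by simp
    then have "q dvd 2" by (simp add: of_int_dvd_zsqrt3_iff)
    then have "q \<le> 2" by (rule zdvd_imp_le) simp
    with \<open>q > 1\<close> have "q = 2" by simp
    with \<open>odd q\<close> show False by simp
  qed
  define h where "h = (\<lambda>i. (rat_part (w ^ i) mod q, sqrt_part (w ^ i) mod q))"
  have h_neq: "h i \<noteq> h j" if "i < j" "j < 2 ^ p" for i j :: nat
  proof
    assume "h i = h j"
    then have "of_int q dvd w ^ j - w ^ i"
      using mod_eq_dvd_iff[of "rat_part (w ^ j)" q "rat_part (w ^ i)"]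
        mod_eq_dvd_iff[of "sqrt_part (w ^ j)" q "sqrt_part (w ^ i)"]
      by (simp add: h_def of_int_dvd_zsqrt3_iff)
    \<comment> \<open>The conjugate of \<open>w ^ i\<close> is its inverse, so multiplying by it
      cancels \<open>w ^ i\<close>.\<close>
    then have "of_int q dvd (w ^ j - w ^ i) * conj3 (w ^ i)" by simp
    moreover have "w ^ j = w ^ (j - i) * w ^ i" using that by (simp flip: power_add)
    then have "(w ^ j - w ^ i) * conj3 (w ^ i) = (w ^ (j - i) - 1) * (w ^ i * conj3 (w ^ i))"
      by (simp add: algebra_simps)
    ultimately show False
      using no_period[of "j - i"] that unit_power_mult_conj3[of i] by (simp add: w_def)
  qed
  have "inj_on h {..<2 ^ p}"
    by (rule inj_onI) (metis h_neq lessThan_iff linorder_neqE_nat)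
  moreover have "h ` {..<2 ^ p} \<subseteq> {0..<q} \<times> {0..<q}"
    using \<open>q > 1\<close> by (auto simp: h_def)
  ultimately have "card {..<2 ^ p :: nat} \<le> card ({0..<q} \<times> {0..<q})"
    by (intro card_inj_on_le) auto
  then have "2 ^ p \<le> nat q * nat q" by (simp add: card_cartesian_product)
  then have "int (2 ^ p) \<le> int (nat q * nat q)" by (simp only: of_nat_le_iff)
  then show ?thesis using \<open>q > 1\<close> by (simp add: power2_eq_square)
qed

text \<open>A composite \<open>2 ^ p - 1\<close> has an odd divisor \<open>q > 1\<close> with
  \<open>q ^ 2\<close> below \<open>2 ^ p\<close>, against the order bound.\<close>

lemma lucas_lehmer_sufficient:
  assumes "p \<ge> 2" and "2 ^ p - 1 dvd rat_part (ZSqrt3 2 1 ^ (2 ^ (p - 2)))"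
  shows "prime (2 ^ p - 1 :: nat)"
proof (rule ccontr)
  let ?M = "2 ^ p - 1 :: nat"
  assume "\<not> prime ?M"
  moreover have "(2::nat) ^ 2 \<le> 2 ^ p" using assms by (intro power_increasing) auto
  then have "?M > 1" by simp
  ultimately obtain a where "a dvd ?M" "a \<noteq> 1" "a \<noteq> ?M"
    unfolding prime_nat_iff by blast
  then obtain b where "?M = a * b" by (elim dvdE)
  with \<open>?M > 1\<close> \<open>a \<noteq> 1\<close> \<open>a \<noteq> ?M\<close> have ab: "?M = a * b" "1 < a" "1 < b"
    by (auto intro!: Nat.gr0I simp: nat_neq_iff)
  obtain q where q: "q dvd ?M" "1 < q" "q ^ 2 \<le> ?M"
  proof (cases "a \<le> b")
    case True
    then show ?thesis using ab by (intro that[of a]) (auto simp: power2_eq_square)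
  next
    case False
    then show ?thesis using ab by (intro that[of b]) (auto simp: power2_eq_square)
  qed
  have "odd ?M" using assms by simp
  then have "odd q" using q(1) dvd_trans by blast
  have "int ?M = 2 ^ p - 1" by (simp add: of_nat_diff)
  then have "int q dvd 2 ^ p - 1" using q(1) by (metis of_nat_dvd_iff)
  then have "2 ^ p \<le> int q ^ 2"
    using assms q \<open>odd q\<close> by (intro unit_power_order_bound) (auto elim: dvd_trans)
  then have "int (2 ^ p) \<le> int (q ^ 2)" by simp
  then have "2 ^ p \<le> q ^ 2" by (simp only: of_nat_le_iff)
  with q(3) \<open>2 ^ 2 \<le> 2 ^ p\<close> show False by simp
qed

text \<open>The power \<open>(1 + sqrt 3) ^ (M + 1)\<close> is computed modulo \<open>M\<close> in
  two ways. Frobenius gives (1 - sqrt 3)(1 + sqrt 3) = -2, since 3 is a nonresidue. Squaring first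
  gives \<open>2 * w ^ 2 ^ (p - 1)\<close>, since 2 is a residue. Hence
  \<open>w ^ 2 ^ (p - 1)\<close> is -1 up to a factor 2, and halving the exponent yields the
  claim.\<close>

lemma lucas_lehmer_necessary:
  assumes "odd p" "p \<ge> 3" and prime: "prime (2 ^ p - 1 :: nat)"
  shows "2 ^ p - 1 dvd rat_part (ZSqrt3 2 1 ^ (2 ^ (p - 2)))"
proof -
  define M where "M = (2 ^ p - 1 :: nat)"
  define w where "w = ZSqrt3 2 1"
  obtain m where m: "p = 2 * m + 3"
  proof -
    from \<open>odd p\<close> obtain k where "p = 2 * k + 1" by (rule oddE)
    with \<open>p \<ge> 3\<close> show ?thesis by (intro that[of "k - 1"]) simp
  qed
  have M_int: "int M = 2 ^ p - 1" by (simp add: M_def of_nat_diff)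
  have "(4::int) ^ m mod 3 = 1" by (induction m) (simp_all, presburger)
  then have M_mod_3: "[int M = 1] (mod 3)"
    by (simp add: M_int m power_add power_mult cong_def) presburger
  have M_half: "(M - 1) div 2 = 2 ^ (p - 1) - 1" "Suc M = 2 * 2 ^ (p - 1)"
    by (simp_all add: M_def m power_add)
  have M_gt: "M > 3"
  proof -
    have "(2::nat) ^ 3 \<le> 2 ^ p" using assms by (intro power_increasing) auto
    then show ?thesis by (simp add: M_def)
  qed
  have "prime M" using prime by (simp add: M_def)
  have "odd M" by (simp add: M_def m)
  \<comment> \<open>An explicit square root of 2 modulo \<open>M\<close> is
    \<open>2 ^ (m + 2)\<close>: its square is \<open>2 ^ (p + 1) = 2 * (M + 1)\<close>. Fermat's
    theorem for this root gives the claim.\<close>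
  have "[2 ^ ((M - 1) div 2) = 1] (mod M)"
  proof -
    have "coprime (2 ^ (m + 2)) M"
      using \<open>odd M\<close> by (simp only: coprime_power_left_iff coprime_left_2_iff_odd simp_thms)
    then have "\<not> M dvd 2 ^ (m + 2)"
      using M_gt coprime_common_divisor_nat[of "2 ^ (m + 2)" M M] by auto
    then have fermat: "[(2 ^ (m + 2)) ^ (M - 1) = 1] (mod M)"
      using fermat_theorem[OF \<open>prime M\<close>] by blast
    have "M - 1 = 2 * ((M - 1) div 2)" using \<open>odd M\<close> by simp
    then have *: "((2::nat) ^ (m + 2)) ^ (M - 1) = (2 ^ (2 * (m + 2))) ^ ((M - 1) div 2)"
      by (metis power_mult mult.commute)
    have "2 ^ (2 * (m + 2)) = 2 * (2::nat) ^ p" by (simp add: m power_add)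
    moreover have "2 ^ p = M + 1" by (simp add: M_def)
    ultimately have "2 ^ (2 * (m + 2)) = M * 2 + 2" by simp
    then have "[2 ^ (2 * (m + 2)) = 2] (mod M)" by (simp only: cong_def mod_mult_self4)
    then have "[(2 ^ (2 * (m + 2))) ^ ((M - 1) div 2) = 2 ^ ((M - 1) div 2)] (mod M)"
      by (rule cong_pow)
    with fermat show ?thesis unfolding * by (metis cong_sym cong_trans)
  qed
  then have "[2 ^ ((M - 1) div 2) = 1] (mod int M)"
    by (metis cong_int_iff of_nat_1 of_nat_numeral of_nat_power)
  then have "of_int (int M) dvd (of_int (2 ^ ((M - 1) div 2) - 1) :: zsqrt3)"
    by (simp only: of_int_dvd_zsqrt3_iff zsqrt3_parts_of_int cong_iff_dvd_diff) simp
  then have two: "of_int (int M) dvd (2 ^ ((M - 1) div 2) - 1 :: zsqrt3)" by simp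
  \<comment> \<open>Both 3 and \<open>M\<close> are 3 modulo 4, so reciprocity contributes the sign
    -1, while \<open>M\<close> is 1 modulo 3 and hence a square there.\<close>
  have "[3 ^ ((M - 1) div 2) = -1] (mod int M)"
  proof -
    have "Legendre 3 (int M) * Legendre (int M) 3 = (-1) ^ ((3 - 1) div 2 * ((M - 1) div 2))"
      using Quadratic_Reciprocity[of 3 M] M_gt \<open>prime M\<close> by simp
    moreover have "QuadRes 3 (int M)"
      using M_mod_3 unfolding QuadRes_def by (intro exI[of _ 1]) (simp add: cong_sym)
    then have "Legendre (int M) 3 = 1"
      using M_mod_3 by (simp add: Legendre_def cong_def)
    moreover have "odd ((M - 1) div 2)" unfolding M_half by (simp add: m)
    ultimately have "Legendre 3 (int M) = -1" by simp
    then show ?thesis using euler_criterion[of M 3] \<open>prime M\<close> M_gt by (simp add: cong_sym)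
  qed
  then have "of_int (int M) dvd (of_int (3 ^ ((M - 1) div 2) - (-1)) :: zsqrt3)"
    by (simp only: of_int_dvd_zsqrt3_iff zsqrt3_parts_of_int cong_iff_dvd_diff) simp
  then have three: "of_int (int M) dvd (3 ^ ((M - 1) div 2) + 1 :: zsqrt3)" by simp
  define I where "I = (of_int (int M) :: zsqrt3)"
  define z where "z = ZSqrt3 1 1"
  define s where "s = ZSqrt3 0 1"
  define h where "h = (M - 1) div 2"
  have M_h: "M = 2 * h + 1" using \<open>odd M\<close> by (simp add: h_def)
  have "I dvd (1 + s) ^ M - (1 ^ M + s ^ M)"
    using prime_dvd_binomial_power_diff[OF \<open>prime M\<close>, of 1 s] by (simp add: I_def)
  moreover have "1 + s = z" by (simp add: s_def z_def zsqrt3_eq_iff)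
  moreover have "s * s = 3" by (simp add: s_def zsqrt3_eq_iff)
  then have "s ^ M = 3 ^ h * s" by (simp add: M_h power_mult power2_eq_square)
  ultimately have "I dvd z ^ M - (1 + 3 ^ h * s)" by simp
  moreover have "I dvd (3 ^ h + 1) * s" using three by (simp add: I_def h_def)
  ultimately have "I dvd (z ^ M - (1 + 3 ^ h * s)) + (3 ^ h + 1) * s" by (rule dvd_add)
  then have "I dvd z ^ M - (1 - s)" by (simp add: algebra_simps)
  \<comment> \<open>One more factor \<open>z\<close> turns the conjugate \<open>1 - s\<close> into
    the norm -2 and makes the exponent \<open>M + 1\<close> a power of two.\<close>
  then have "I dvd (z ^ M - (1 - s)) * z" by simp
  moreover have "(1 - s) * z = -2" by (simp add: s_def z_def zsqrt3_eq_iff)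
  then have "(z ^ M - (1 - s)) * z = z ^ Suc M + 2" by (simp add: algebra_simps)
  moreover have "z ^ Suc M = 2 * 2 ^ h * w ^ (2 ^ (p - 1))"
  proof -
    have "z ^ Suc M = (z ^ 2) ^ (2 ^ (p - 1))" by (simp only: M_half power_mult)
    also have "\<dots> = 2 ^ Suc h * w ^ (2 ^ (p - 1))"
      unfolding z_def one_plus_sqrt3_square power_mult_distrib w_def h_def M_half by simp
    finally show ?thesis by simp
  qed
  ultimately have "I dvd 2 * 2 ^ h * w ^ (2 ^ (p - 1)) + 2" by simp
  moreover have "I dvd (2 ^ h - 1) * (2 * w ^ (2 ^ (p - 1)))" using two by (simp add: I_def h_def)
  ultimately have "I dvd (2 * 2 ^ h * w ^ (2 ^ (p - 1)) + 2) - (2 ^ h - 1) * (2 * w ^ (2 ^ (p - 1)))"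
    by (rule dvd_diff)
  then have "I dvd 2 * w ^ (2 ^ (p - 1)) + 2" by (simp add: algebra_simps)
  then have "int M dvd 2 * rat_part (w ^ (2 ^ (p - 1))) + 2"
    unfolding I_def of_int_dvd_zsqrt3_iff by simp
  \<comment> \<open>By the doubling formula the \<open>+ 2\<close> cancels, leaving four times a
    square, and \<open>M\<close> is an odd prime.\<close>
  moreover have "2 ^ (p - 1) = (2 * 2 ^ (p - 2) :: nat)" by (simp add: m power_add)
  ultimately have "int M dvd 2 ^ 2 * rat_part (w ^ (2 ^ (p - 2))) ^ 2"
    by (simp add: w_def rat_part_unit_power_double)
  moreover have "coprime (int M) (2 ^ 2)"
    using \<open>odd M\<close> by (simp only: coprime_power_right_iff coprime_right_2_iff_odd even_of_nat simp_thms)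
  ultimately have "int M dvd rat_part (w ^ (2 ^ (p - 2))) ^ 2"
    by (simp only: coprime_dvd_mult_right_iff)
  then have "int M dvd rat_part (w ^ (2 ^ (p - 2)))"
    using \<open>prime M\<close> by (metis prime_dvd_power prime_int_nat_transfer prime_nat_int_transfer)
  then show ?thesis by (simp add: M_int w_def)
qed

section \<open>The two ratios\<close>

lemma A_ratio_eq:
  assumes "odd p" "p > 1"
  shows "A_ratio p = of_int (2 ^ p - 1)"
proof -
  have "A_seq p 0 (p div 2)
      = (\<Sum>j\<le>p div 2. int (lucas_coeff p j) * 1 ^ (p div 2 - j) * 2 ^ j) * (\<Prod>i=1..p div 2. int p - int i)"
    by (rule lattice_recurrence_eq_lucas_sum[where Q = "int p"]) (use assms in auto)
  \<comment> \<open>The numbers 2 and -1 have sum 1 and negated product 2, and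
    \<open>(-1) ^ p = -1\<close> for odd \<open>p\<close>.\<close>
  also have "(\<Sum>j\<le>p div 2. int (lucas_coeff p j) * 1 ^ (p div 2 - j) * 2 ^ j) = 2 ^ p - 1"
    using lucas_coeff_sum[of p 2 "-1 :: int"] \<open>odd p\<close> by simp
  finally have seq: "A_seq p 0 (p div 2) = (2 ^ p - 1) * (\<Prod>i=1..p div 2. int p - int i)" .
  have "p div 2 < p" using assms by simp
  then show ?thesis unfolding A_ratio_def seq by (rule falling_prod_ratio)
qed

lemma B_ratio_eq:
  assumes "even K" "K > 0"
  shows "B_ratio (2 * K) = of_int (2 * rat_part (ZSqrt3 2 1 ^ K))"
proof -
  define S where "S = (\<Sum>j\<le>K. int (lucas_coeff (2 * K) j) * (-2) ^ (K - j) * (-1) ^ j)"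
  define z where "z = ZSqrt3 1 1"
  have seq: "B_seq (2 * K) 0 K = S * (\<Prod>i=1..K. int (2 * K) - int i)"
    unfolding S_def
    by (rule lattice_recurrence_eq_lucas_sum[where Q = "int (2 * K) - 1"])
      (use assms in \<open>auto simp: algebra_simps\<close>)
  have "2 * K div 2 = K" "K < 2 * K" using assms by simp_all
  then have "B_ratio (2 * K) = of_int S"
    unfolding B_ratio_def \<open>2 * K div 2 = K\<close> seq by (intro falling_prod_ratio)
  \<comment> \<open>The factor \<open>2 ^ K\<close> balances the exponents to fit sum 2 and negated
    product 2, which belong to 1 + sqrt 3 and its conjugate. The remaining sign
    \<open>(-1) ^ K\<close> is 1 because \<open>K\<close> is even.\<close>
  moreover have "of_int (2 ^ K * S) = z ^ (2 * K) + conj3 z ^ (2 * K)"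
  proof -
    have "2 ^ K * S = (\<Sum>j\<le>K. int (lucas_coeff (2 * K) j) * 2 ^ (2 * K - 2 * j) * 2 ^ j)"
      unfolding S_def sum_distrib_left
    proof (rule sum.cong[OF refl])
      fix j assume "j \<in> {..K}"
      then obtain d where d: "K = j + d" by (auto dest: le_Suc_ex)
      have "(-2) ^ d * (-1) ^ j = (2 ^ d :: int) * (-1) ^ K"
        by (simp add: d power_add power_minus[of 2])
      with \<open>even K\<close> have "(-2) ^ d * (-1) ^ j = (2 ^ d :: int)" by simp
      then show "2 ^ K * (int (lucas_coeff (2 * K) j) * (-2) ^ (K - j) * (-1) ^ j)
          = int (lucas_coeff (2 * K) j) * 2 ^ (2 * K - 2 * j) * 2 ^ j"
        by (simp add: d power_add mult_2 mult.assoc)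
    qed
    moreover have "z + conj3 z = 2" "- (z * conj3 z) = 2" by (simp_all add: z_def zsqrt3_eq_iff)
    ultimately show ?thesis using lucas_coeff_sum[of "2 * K" z "conj3 z"] by simp
  qed
  moreover have "z ^ (2 * K) = of_int (2 ^ K) * ZSqrt3 2 1 ^ K"
    unfolding z_def power_mult one_plus_sqrt3_square by (simp add: power_mult_distrib)
  ultimately have "rat_part (of_int (2 ^ K * S)) = 2 ^ K * (2 * rat_part (ZSqrt3 2 1 ^ K))"
    by (simp only: zsqrt3_parts zsqrt3_parts_of_int conj3_parts flip: conj3_power)
  then have "S = 2 * rat_part (ZSqrt3 2 1 ^ K)"
    by (simp only: zsqrt3_parts_of_int) simp
  with \<open>B_ratio (2 * K) = of_int S\<close> show ?thesis by simp
qed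

theorem theorem9:
  fixes p n :: nat
  assumes "prime p" and "p \<ge> 5" and "n = 2 ^ (p - 1)"
  shows "\<exists>a b :: int. A_ratio p = of_int a \<and> B_ratio n = of_int b \<and>
           (prime (2 ^ p - 1 :: nat) \<longleftrightarrow> a dvd b)"
proof (intro exI conjI)
  have "odd p" using assms prime_odd_nat by simp
  show "A_ratio p = of_int (2 ^ p - 1)"
    using \<open>odd p\<close> assms by (intro A_ratio_eq) auto
  have "n = 2 * 2 ^ (p - 2)"
    using assms by (simp add: Suc_diff_le numeral_2_eq_2 flip: power_Suc)
  then show "B_ratio n = of_int (2 * rat_part (ZSqrt3 2 1 ^ (2 ^ (p - 2))))"
    using assms by (simp only:) (intro B_ratio_eq; simp)
  \<comment> \<open>The trace is twice the rational part. The modulus is odd, so this 2 does not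
    affect divisibility.\<close>
  have "coprime (2 ^ p - 1) (2 :: int)"
    using assms by simp
  then have "2 ^ p - 1 dvd 2 * rat_part (ZSqrt3 2 1 ^ (2 ^ (p - 2)))
      \<longleftrightarrow> 2 ^ p - 1 dvd rat_part (ZSqrt3 2 1 ^ (2 ^ (p - 2)))"
    by (rule coprime_dvd_mult_right_iff)
  then show "prime (2 ^ p - 1 :: nat) \<longleftrightarrow> 2 ^ p - 1 dvd 2 * rat_part (ZSqrt3 2 1 ^ (2 ^ (p - 2)))"
    using lucas_lehmer_sufficient[of p] lucas_lehmer_necessary[of p] \<open>odd p\<close> assms by auto
qed

end
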